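(* Let $d\ge 4$ be an integer. There exist a constant $c_d>0$ and an integer $n_0(d)$ such that for every $n\ge n_0(d)$: if $\mathcal{F}\subseteq\binom{[n]}{d+1}$ has VC-dimension at most $d$, then $|\mathcal{F}|\le\binom{n}{d}-c_d n^{d-4}$.
   Context: $\binom{[n]}{k}$ denotes the family of all $k$-element subsets of $[n]$. A family $\mathcal{F}$ shatters $S$ if for every $A\subseteq S$ there is $F\in\mathcal{F}$ with $F\cap S=A$; the VC-dimension of $\mathcal{F}$ is the largest size of a shattered set. *)

theory Defs
  imports Complex_Main
begin

definition shatters :: "'a set set \<Rightarrow> 'a set \<Rightarrow> bool" where
  "shatters F S \<longleftrightarrow> (\<forall>A\<subseteq>S. \<exists>X\<in>F. X \<inter> S = A)"

text \<open>VC-dimension: the largest size of a (finite) shattered set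
  (Sup on nat; for the finite families considered here the set is finite).\<close>
definition vc_dim :: "'a set set \<Rightarrow> nat" where
  "vc_dim F = Sup {card S | S. finite S \<and> shatters F S}"

definition k_subsets :: "nat \<Rightarrow> nat \<Rightarrow> nat set set" where
  "k_subsets n k = {A. A \<subseteq> {1..n} \<and> card A = k}"

end

theory Submission
  imports Defs "HOL-Library.Function_Algebras"
begin

text \<open>
  Give each \<open>f \<in> F\<close> an inclusion-maximal \<open>b f \<subset> f\<close> that is not the trace on \<open>f\<close> of a member of \<open>F\<close>.
  As in the argument of Frankl and Pach, on the slice of \<open>(d + 1)\<close>-sets the indicator of
  \<open>X = f\<close> minus \<open>\<plusminus>\<close> the indicator of \<open>X \<inter> f = b f\<close> is a polynomial \<open>P f\<close> of degree at most \<open>d\<close>, and on \<open>F\<close>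
  the \<open>P f\<close> are dual to the points. So \<open>w A\<close>, the monomial of \<open>A\<close> minus the sum of \<open>P f\<close> over
  \<open>f \<supseteq> A\<close>, vanishes on \<open>F\<close>; if \<open>F\<close> falls short of the dimension \<open>n choose d\<close> by less than
  \<open>n ^ (d - 4)\<close>, then there are fewer than \<open>n ^ (d - 4)\<close> further points such that a polynomial of
  degree at most \<open>d\<close> vanishing on \<open>F\<close> and at these points is zero on the slice.

  Members with \<open>card (b f) \<le> d - 2\<close> are rare: \<open>f - b f\<close> is a minimal cover of the link of \<open>b f\<close>, and
  there are boundedly many minimal covers of bounded size. Hence for all but \<open>O(n ^ (d - 2))\<close> of the
  \<open>(d - 1)\<close>-sets \<open>S\<close>, the functions \<open>w S\<close> and \<open>w (insert a S)\<close> vanish at the further points because these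
  are far from \<open>S\<close>, so they vanish identically. Their values then force every \<open>(d + 1)\<close>-set containing
  \<open>S\<close> to lie in \<open>F\<close>, which makes \<open>F\<close> larger than \<open>n choose d\<close>.
\<close>

section \<open>Elementary counts of finite sets\<close>

lemma finite_k_subsets [simp]: "finite (k_subsets n k)"
  by (rule finite_subset[of _ "Pow {1..n}"]) (auto simp: k_subsets_def)

lemma card_k_subsets: "card (k_subsets n k) = n choose k"
  using n_subsets[of "{1..n}" k] by (simp add: k_subsets_def)

lemma k_subsets_finite: "A \<in> k_subsets n k \<Longrightarrow> finite A"
  by (auto simp: k_subsets_def intro: finite_subset)

text \<open>Sets of size at most \<open>Suc j\<close> arise from sets of size at most
  \<open>j\<close> by inserting a point of \<open>U\<close> or nothing (\<open>None\<close>), so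
  each step costs a factor \<open>card U + 1\<close>.\<close>

lemma card_subsets_le:
  assumes "finite U"
  shows "card {A. A \<subseteq> U \<and> card A \<le> j} \<le> (card U + 1) ^ j"
proof (induction j)
  case 0
  have "{A. A \<subseteq> U \<and> card A \<le> 0} = {{}}"
    using assms finite_subset by fastforce
  then show ?case by simp
next
  case (Suc j)
  let ?T = "{A. A \<subseteq> U \<and> card A \<le> j}"
  let ?ins = "\<lambda>(x, A). case x of None \<Rightarrow> A | Some y \<Rightarrow> insert y A"
  have fin: "finite ?T"
    by (rule finite_subset[of _ "Pow U"]) (use assms in auto)
  have "A \<in> ?ins ` (insert None (Some ` U) \<times> ?T)" if "A \<subseteq> U" "card A \<le> Suc j" for A
  proof (cases "A = {}")
    case True
    then have "A = ?ins (None, {})" "(None, {}) \<in> insert None (Some ` U) \<times> ?T" by auto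
    then show ?thesis by blast
  next
    case False
    then obtain y where y: "y \<in> A" by blast
    have "finite A" using that assms finite_subset by blast
    then have "A = ?ins (Some y, A - {y})" "(Some y, A - {y}) \<in> insert None (Some ` U) \<times> ?T"
      using y that by auto
    then show ?thesis by blast
  qed
  then have "{A. A \<subseteq> U \<and> card A \<le> Suc j} \<subseteq> ?ins ` (insert None (Some ` U) \<times> ?T)" by blast
  then have "card {A. A \<subseteq> U \<and> card A \<le> Suc j} \<le> card (insert None (Some ` U) \<times> ?T)"
    using fin assms by (meson card_image_le card_mono finite_SigmaI finite_imageI finite_insert order_trans)
  also have "\<dots> = (card U + 1) * card ?T"
    using assms by (simp add: card_cartesian_product card_image image_iff)
  also have "\<dots> \<le> (card U + 1) * (card U + 1) ^ j"
    using Suc.IH by (rule mult_le_mono2)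
  finally show ?case by simp
qed

subsection \<open>Minimal covers\<close>

text \<open>The private edge demanded at each point expresses inclusion-minimality: dropping the
  point would leave that edge uncovered.\<close>

definition min_covers :: "'a set set \<Rightarrow> 'a set set" where
  "min_covers H = {C. finite C \<and> (\<forall>E\<in>H. C \<inter> E \<noteq> {}) \<and> (\<forall>x\<in>C. \<exists>E\<in>H. C \<inter> E = {x})}"

text \<open>Branching: if \<open>T\<close> meets every edge, the only minimal cover that can extend
  it is \<open>T\<close>; otherwise the cover contains one of the at most \<open>k\<close> points of
  an edge missed by \<open>T\<close>, and the budget \<open>m\<close> drops by one.\<close>

lemma card_min_covers_extending:
  assumes H: "\<And>E. E \<in> H \<Longrightarrow> finite E \<and> card E \<le> k" and "k \<ge> 1"
  shows "finite {C \<in> min_covers H. T \<subseteq> C \<and> card C \<le> card T + m} \<and>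
    card {C \<in> min_covers H. T \<subseteq> C \<and> card C \<le> card T + m} \<le> k ^ m"
proof (induction m arbitrary: T)
  case 0
  have "C = T" if "C \<in> min_covers H" "T \<subseteq> C" "card C \<le> card T" for C
    using that card_seteq[of C T] by (auto simp: min_covers_def)
  then have sub: "{C \<in> min_covers H. T \<subseteq> C \<and> card C \<le> card T + 0} \<subseteq> {T}" by auto
  show ?case using card_mono[OF _ sub] finite_subset[OF sub] by simp
next
  case (Suc m)
  let ?N = "\<lambda>T m. {C \<in> min_covers H. T \<subseteq> C \<and> card C \<le> card T + m}"
  show ?case
  proof (cases "\<forall>E\<in>H. T \<inter> E \<noteq> {}")
    case True
    have "C = T" if C: "C \<in> min_covers H" "T \<subseteq> C" for C
    proof (rule ccontr)
      assume "C \<noteq> T"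
      then obtain x where x: "x \<in> C" "x \<notin> T" using C by blast
      then obtain E where E: "E \<in> H" "C \<inter> E = {x}" using C by (auto simp: min_covers_def)
      then have "T \<inter> E \<subseteq> {x}" using C(2) by blast
      then have "T \<inter> E = {}" using x(2) by blast
      then show False using True E(1) by blast
    qed
    then have "?N T (Suc m) \<subseteq> {T}" by blast
    then have "finite (?N T (Suc m))" "card (?N T (Suc m)) \<le> 1"
      using card_mono[of "{T}" "?N T (Suc m)"] finite_subset[of "?N T (Suc m)" "{T}"] by simp_all
    then show ?thesis using one_le_power[OF \<open>k \<ge> 1\<close>] le_trans by blast
  next
    case False
    then obtain E where E: "E \<in> H" "T \<inter> E = {}" by blast
    have sub: "?N T (Suc m) \<subseteq> (\<Union>x\<in>E. ?N (insert x T) m)"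
    proof
      fix C assume C: "C \<in> ?N T (Suc m)"
      then have "C \<inter> E \<noteq> {}" using E unfolding min_covers_def by blast
      then obtain x where x: "x \<in> C" "x \<in> E" by blast
      have "finite T" using C finite_subset by (auto simp: min_covers_def)
      moreover have "x \<notin> T" using x E by blast
      ultimately have "card (insert x T) = Suc (card T)" by simp
      then have "C \<in> ?N (insert x T) m" using C x by auto
      then show "C \<in> (\<Union>x\<in>E. ?N (insert x T) m)" using x by blast
    qed
    have fin: "finite (\<Union>x\<in>E. ?N (insert x T) m)"
      using Suc.IH H[OF E(1)] by blast
    have "card (\<Union>x\<in>E. ?N (insert x T) m) \<le> (\<Sum>x\<in>E. card (?N (insert x T) m))"
      using H[OF E(1)] card_UN_le by blast
    also have "\<dots> \<le> (\<Sum>x\<in>E. k ^ m)"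
      using Suc.IH by (intro sum_mono) blast
    also have "\<dots> \<le> k ^ Suc m" using H[OF E(1)] by simp
    finally show ?thesis using card_mono[OF fin sub] finite_subset[OF sub fin] by linarith
  qed
qed

lemma card_min_covers:
  assumes "\<And>E. E \<in> H \<Longrightarrow> finite E \<and> card E \<le> k" and "k \<ge> 1"
  shows "finite {C \<in> min_covers H. card C \<le> k}" "card {C \<in> min_covers H. card C \<le> k} \<le> k ^ k"
  using card_min_covers_extending[of H k "{}" k] assms by auto

subsection \<open>Low-degree functions on a slice\<close>

text \<open>The indicators of the points of \<open>I\<close> are linearly independent, and duality
  puts them into the span of \<open>card J\<close> functions.\<close>

lemma card_le_of_dual_functions:
  fixes a :: "'j \<Rightarrow> 'i \<Rightarrow> real"
  assumes "finite I" "finite J"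
    and dual: "\<And>i. i \<in> I \<Longrightarrow> \<exists>c. \<forall>i'\<in>I. (\<Sum>j\<in>J. c j * a j i') = of_bool (i' = i)"
  shows "card I \<le> card J"
proof -
  define sc :: "real \<Rightarrow> ('i \<Rightarrow> real) \<Rightarrow> 'i \<Rightarrow> real" where "sc = (\<lambda>r f x. r * f x)"
  interpret fs: vector_space sc
    by standard (auto simp: sc_def fun_eq_iff algebra_simps)
  \<comment> \<open>Cutting off outside \<open>I\<close> turns identities known only on
    \<open>I\<close> into equalities of functions.\<close>
  define v where "v j = (\<lambda>x. of_bool (x \<in> I) * a j x)" for j
  define e :: "'i \<Rightarrow> 'i \<Rightarrow> real" where "e i = (\<lambda>x. of_bool (x = i))" for i
  have fun_sum: "(\<Sum>k\<in>K. f k) x = (\<Sum>k\<in>K. f k x)" for K :: "'k set" and f :: "'k \<Rightarrow> 'i \<Rightarrow> real" and x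
    by (induction K rule: infinite_finite_induct) auto
  have e_eval: "e i i = 1" "i' \<noteq> i \<Longrightarrow> e i' i = 0" for i i' by (auto simp: e_def)
  then have inj: "inj e" by (metis injI zero_neq_one)
  have "e i \<in> fs.span (v ` J)" if "i \<in> I" for i
  proof -
    obtain c where c: "\<forall>i'\<in>I. (\<Sum>j\<in>J. c j * a j i') = of_bool (i' = i)" using dual \<open>i \<in> I\<close> by blast
    have "e i = (\<Sum>j\<in>J. sc (c j) (v j))"
      using c \<open>i \<in> I\<close> by (auto simp: fun_eq_iff fun_sum e_def v_def sc_def)
    then show ?thesis
      by (simp add: fs.span_sum fs.span_scale fs.span_base)
  qed
  moreover have "fs.independent (e ` I)"
  proof -
    have "u f = 0" if u: "(\<Sum>f\<in>e ` I. sc (u f) f) = 0" and f: "f \<in> e ` I" for u f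
    proof -
      obtain i where i: "i \<in> I" "f = e i" using f by blast
      have "0 = (\<Sum>f\<in>e ` I. sc (u f) f) i" using u by simp
      also have "\<dots> = (\<Sum>f\<in>e ` I. u f * f i)" by (simp add: fun_sum sc_def)
      also have "\<dots> = (\<Sum>k\<in>I. u (e k) * e k i)"
        by (rule sum.reindex_cong[OF inj_on_subset[OF inj]]) auto
      also have "\<dots> = (\<Sum>k\<in>I. if k = i then u (e k) else 0)"
        by (intro sum.cong) (auto simp: e_def)
      also have "\<dots> = u f" using i \<open>finite I\<close> by simp
      finally show ?thesis by simp
    qed
    then show ?thesis using fs.dependent_finite[of "e ` I"] \<open>finite I\<close> by blast
  qed
  ultimately have "card (e ` I) \<le> card (v ` J)"
    using fs.independent_span_bound[of "v ` J" "e ` I"] assms by blast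
  then show ?thesis
    using card_image_le[OF \<open>finite J\<close>, of v] card_image[OF inj_on_subset[OF inj]] by fastforce
qed


text \<open>These are the polynomials of degree at most \<open>d\<close> on the slice: monomials of
  size exactly \<open>d\<close> suffice there, which makes the bound \<open>n choose d\<close> on
  the dimension visible. Values off the slice are left free.\<close>

definition low_degree :: "nat \<Rightarrow> nat \<Rightarrow> (nat set \<Rightarrow> real) set" where
  "low_degree n d = {f. \<exists>c. \<forall>X\<in>k_subsets n (d + 1).
     f X = (\<Sum>D\<in>k_subsets n d. c D * of_bool (D \<subseteq> X))}"

lemma low_degreeE:
  assumes "f \<in> low_degree n d"
  obtains c where "\<And>X. X \<in> k_subsets n (d + 1) \<Longrightarrow>
    f X = (\<Sum>D\<in>k_subsets n d. c D * of_bool (D \<subseteq> X))"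
  using assms by (auto simp: low_degree_def)

lemma low_degree_zero: "(\<lambda>X. 0) \<in> low_degree n d"
  unfolding low_degree_def by (intro CollectI exI[of _ "\<lambda>_. 0"]) simp

lemma low_degree_add_scale:
  assumes "f \<in> low_degree n d" "g \<in> low_degree n d"
  shows "(\<lambda>X. f X + r * g X) \<in> low_degree n d"
proof -
  from assms(1) obtain c where c: "\<And>X. X \<in> k_subsets n (d + 1) \<Longrightarrow>
    f X = (\<Sum>D\<in>k_subsets n d. c D * of_bool (D \<subseteq> X))" by (rule low_degreeE) blast
  from assms(2) obtain c' where c': "\<And>X. X \<in> k_subsets n (d + 1) \<Longrightarrow>
    g X = (\<Sum>D\<in>k_subsets n d. c' D * of_bool (D \<subseteq> X))" by (rule low_degreeE) blast
  have "f X + r * g X = (\<Sum>D\<in>k_subsets n d. (c D + r * c' D) * of_bool (D \<subseteq> X))"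
    if "X \<in> k_subsets n (d + 1)" for X
    by (simp only: c[OF that] c'[OF that] sum_distrib_left sum.distrib distrib_right mult.assoc)
  then show ?thesis unfolding low_degree_def by (intro CollectI exI ballI)
qed

lemma low_degree_diff:
  "f \<in> low_degree n d \<Longrightarrow> g \<in> low_degree n d \<Longrightarrow> (\<lambda>X. f X - g X) \<in> low_degree n d"
  using low_degree_add_scale[of f n d g "-1"] by simp

lemma low_degree_scale: "f \<in> low_degree n d \<Longrightarrow> (\<lambda>X. r * f X) \<in> low_degree n d"
  using low_degree_add_scale[OF low_degree_zero, of f n d r] by simp

lemma low_degree_sum:
  "(\<And>i. i \<in> I \<Longrightarrow> f i \<in> low_degree n d) \<Longrightarrow> (\<lambda>X. \<Sum>i\<in>I. f i X) \<in> low_degree n d"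
proof (induction I rule: infinite_finite_induct)
  case (insert i I)
  then show ?case using low_degree_add_scale[of "f i" n d "\<lambda>X. \<Sum>i\<in>I. f i X" 1] by simp
qed (auto simp: low_degree_zero)

text \<open>Averaging: a \<open>(d + 1)\<close>-set containing \<open>A\<close> has exactly
  \<open>d + 1 - card A\<close> subsets of size \<open>d\<close> that still contain
  \<open>A\<close>.\<close>

lemma low_degree_monomial:
  assumes "card A \<le> d"
  shows "(\<lambda>X. of_bool (A \<subseteq> X)) \<in> low_degree n d"
proof -
  have "of_bool (A \<subseteq> X) =
      (\<Sum>D\<in>k_subsets n d. of_bool (A \<subseteq> D) / real (d + 1 - card A) * of_bool (D \<subseteq> X))"
    if X: "X \<in> k_subsets n (d + 1)" for X
  proof (cases "A \<subseteq> X")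
    case True
    have X': "X \<subseteq> {1..n}" "card X = d + 1" "finite X"
      using X k_subsets_finite[OF X] by (auto simp: k_subsets_def)
    have "{D \<in> k_subsets n d. A \<subseteq> D \<and> D \<subseteq> X} = (\<lambda>x. X - {x}) ` (X - A)"
    proof (intro equalityI subsetI)
      fix D assume D: "D \<in> {D \<in> k_subsets n d. A \<subseteq> D \<and> D \<subseteq> X}"
      then have "card (X - D) = 1"
        using X' k_subsets_finite[of D n d] by (simp add: card_Diff_subset k_subsets_def)
      then obtain x where x: "X - D = {x}" using card_1_singletonE by blast
      then have "D = X - {x}" using D by blast
      moreover have "x \<in> X - A" using D x by blast
      ultimately show "D \<in> (\<lambda>x. X - {x}) ` (X - A)" by blast
    next
      fix D assume "D \<in> (\<lambda>x. X - {x}) ` (X - A)"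
      then show "D \<in> {D \<in> k_subsets n d. A \<subseteq> D \<and> D \<subseteq> X}"
        using X' True by (auto simp: k_subsets_def)
    qed
    moreover have "inj_on (\<lambda>x. X - {x}) (X - A)" by (auto simp: inj_on_def)
    moreover have "card (X - A) = d + 1 - card A"
      using X' True by (metis card_Diff_subset finite_subset)
    ultimately have "card {D \<in> k_subsets n d. A \<subseteq> D \<and> D \<subseteq> X} = d + 1 - card A"
      by (simp add: card_image)
    moreover have "(\<Sum>D\<in>k_subsets n d. of_bool (A \<subseteq> D) / real (d + 1 - card A) * of_bool (D \<subseteq> X))
        = (\<Sum>D\<in>k_subsets n d. if A \<subseteq> D \<and> D \<subseteq> X then 1 / real (d + 1 - card A) else 0)"
      by (intro sum.cong) auto
    ultimately show ?thesis using True assms by (simp add: sum.If_cases Int_def)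
  next
    case False
    then have "\<not> D \<subseteq> X" if "A \<subseteq> D" for D using that by blast
    then have "of_bool (A \<subseteq> D) / real (d + 1 - card A) * of_bool (D \<subseteq> X) = 0" for D
      by (cases "A \<subseteq> D") simp_all
    then show ?thesis using False by (simp only: sum.neutral_const of_bool_eq simp_thms)
  qed
  then show ?thesis unfolding low_degree_def by (intro CollectI exI ballI)
qed

lemma of_bool_avoid_insert:
  "q \<notin> Q \<Longrightarrow> of_bool (P \<subseteq> X \<and> insert q Q \<inter> X = {}) =
    (of_bool (P \<subseteq> X \<and> Q \<inter> X = {}) - of_bool (insert q P \<subseteq> X \<and> Q \<inter> X = {}) :: real)"
  by auto

text \<open>Expand the product of the factors \<open>1 - x_q\<close>, for \<open>q\<close> in
  \<open>Q\<close>, one factor at a time.\<close>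

lemma low_degree_avoid:
  assumes "finite Q" "finite P" "card P + card Q \<le> d"
  shows "(\<lambda>X. of_bool (P \<subseteq> X \<and> Q \<inter> X = {})) \<in> low_degree n d"
  using assms
proof (induction Q arbitrary: P rule: finite_induct)
  case empty
  then show ?case using low_degree_monomial by simp
next
  case (insert q Q)
  moreover have "card (insert q P) + card Q \<le> d"
    using insert card_insert_le_m1[of "Suc (card P)" P q] by (simp add: card_insert_if)
  ultimately show ?case
    unfolding of_bool_avoid_insert[OF \<open>q \<notin> Q\<close>] by (intro low_degree_diff insert.IH) auto
qed

text \<open>One degree higher, the same expansion has a single term of degree \<open>d + 1\<close>,
  the signed monomial of \<open>P \<union> Q\<close>.\<close>

lemma low_degree_avoid_top:
  assumes "finite Q" "finite P" "P \<inter> Q = {}" "card P + card Q = d + 1"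
  shows "(\<lambda>X. of_bool (P \<subseteq> X \<and> Q \<inter> X = {}) - (- 1) ^ card Q * of_bool (P \<union> Q \<subseteq> X)) \<in> low_degree n d"
  using assms
proof (induction Q arbitrary: P rule: finite_induct)
  case empty
  then show ?case using low_degree_zero by simp
next
  case (insert q Q)
  have "(\<lambda>X. of_bool (insert q P \<subseteq> X \<and> Q \<inter> X = {}) - (- 1) ^ card Q * of_bool (insert q P \<union> Q \<subseteq> X))
      \<in> low_degree n d"
    using insert by (intro insert.IH) auto
  moreover have "(\<lambda>X. of_bool (P \<subseteq> X \<and> Q \<inter> X = {})) \<in> low_degree n d"
    using insert by (intro low_degree_avoid) auto
  moreover have "insert q P \<union> Q = P \<union> insert q Q" by blast
  ultimately show ?case
    unfolding of_bool_avoid_insert[OF \<open>q \<notin> Q\<close>]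
    using low_degree_diff[of "\<lambda>X. of_bool (P \<subseteq> X \<and> Q \<inter> X = {})" n d
        "\<lambda>X. of_bool (insert q P \<subseteq> X \<and> Q \<inter> X = {}) - (- 1) ^ card Q * of_bool (insert q P \<union> Q \<subseteq> X)"]
      insert by (simp add: algebra_simps)
qed

text \<open>Dual functions exist exactly when the evaluations at the points of \<open>Y\<close> are
  linearly independent functionals on \<open>low_degree n d\<close>.\<close>

definition dual_set :: "nat \<Rightarrow> nat \<Rightarrow> nat set set \<Rightarrow> bool" where
  "dual_set n d Y \<longleftrightarrow> Y \<subseteq> k_subsets n (d + 1) \<and>
     (\<forall>Z\<in>Y. \<exists>g\<in>low_degree n d. \<forall>Z'\<in>Y. g Z' = of_bool (Z' = Z))"

lemma card_dual_set_le:
  assumes "dual_set n d Y"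
  shows "card Y \<le> n choose d"
proof -
  have "card Y \<le> card (k_subsets n d)"
  proof (rule card_le_of_dual_functions[where a = "\<lambda>D X. of_bool (D \<subseteq> X)"])
    show "finite Y" using assms finite_subset[OF _ finite_k_subsets] unfolding dual_set_def by blast
    fix Z assume "Z \<in> Y"
    then obtain g where gl: "g \<in> low_degree n d" and g: "\<forall>Z'\<in>Y. g Z' = of_bool (Z' = Z)"
      using assms by (auto simp: dual_set_def)
    from gl obtain c where c: "\<And>X. X \<in> k_subsets n (d + 1) \<Longrightarrow>
      g X = (\<Sum>D\<in>k_subsets n d. c D * of_bool (D \<subseteq> X))" by (rule low_degreeE) blast
    have "(\<Sum>D\<in>k_subsets n d. c D * of_bool (D \<subseteq> Z')) = of_bool (Z' = Z)" if "Z' \<in> Y" for Z'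
    proof -
      have "Z' \<in> k_subsets n (d + 1)" using assms that by (auto simp: dual_set_def)
      then show ?thesis by (simp only: c[symmetric] g[rule_format, OF that])
    qed
    then have "\<forall>Z'\<in>Y. (\<Sum>D\<in>k_subsets n d. c D * of_bool (D \<subseteq> Z')) = of_bool (Z' = Z)"
      by simp
    then show "\<exists>c::_ \<Rightarrow> real. \<forall>Z'\<in>Y. (\<Sum>D\<in>k_subsets n d. c D * of_bool (D \<subseteq> Z')) = of_bool (Z' = Z)"
      by (rule exI[of _ c])
  qed simp
  then show ?thesis by (simp add: card_k_subsets)
qed

text \<open>A maximal dual set works: if \<open>h\<close> vanished on \<open>Y\<close> but not at
  \<open>X\<close>, a multiple of \<open>h\<close> would be dual to \<open>X\<close>, and other
  multiples would correct the old dual functions at \<open>X\<close>, so \<open>X\<close> could be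
  added.\<close>

lemma dual_set_extend:
  assumes "dual_set n d F"
  obtains Y where "F \<subseteq> Y" "dual_set n d Y"
    "\<And>h X. h \<in> low_degree n d \<Longrightarrow> (\<And>Z. Z \<in> Y \<Longrightarrow> h Z = 0) \<Longrightarrow> X \<in> k_subsets n (d + 1) \<Longrightarrow> h X = 0"
proof -
  let ?A = "{Y. F \<subseteq> Y \<and> dual_set n d Y}"
  have "finite ?A"
    by (rule finite_subset[of _ "Pow (k_subsets n (d + 1))"]) (auto simp: dual_set_def)
  moreover have "?A \<noteq> {}" using assms by blast
  ultimately have "\<exists>Y\<in>?A. \<forall>Y'\<in>?A. Y \<subseteq> Y' \<longrightarrow> Y = Y'" by (rule finite_has_maximal)
  then obtain Y where Y: "Y \<in> ?A" and max: "\<And>Y'. Y' \<in> ?A \<Longrightarrow> Y \<subseteq> Y' \<Longrightarrow> Y = Y'" by metis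
  have "h X = 0"
    if h: "h \<in> low_degree n d" and h0: "\<And>Z. Z \<in> Y \<Longrightarrow> h Z = 0" and X: "X \<in> k_subsets n (d + 1)" for h X
  proof (rule ccontr)
    assume hX: "h X \<noteq> 0"
    then have XY: "X \<notin> Y" using h0 by blast
    have "\<exists>g\<in>low_degree n d. \<forall>Z'\<in>insert X Y. g Z' = of_bool (Z' = Z)" if "Z \<in> insert X Y" for Z
    proof (cases "Z = X")
      case True
      define k where "k = (\<lambda>W. inverse (h X) * h W)"
      have "k \<in> low_degree n d" unfolding k_def using h by (rule low_degree_scale)
      moreover have "\<forall>Z'\<in>insert X Y. k Z' = of_bool (Z' = Z)"
        using True hX h0 XY by (auto simp: k_def)
      ultimately show ?thesis by blast
    next
      case False
      then have "Z \<in> Y" using that by blast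
      then obtain g where g: "g \<in> low_degree n d" "\<forall>Z'\<in>Y. g Z' = of_bool (Z' = Z)"
        using Y by (auto simp: dual_set_def)
      define k where "k = (\<lambda>W. g W + (- g X / h X) * h W)"
      have "k \<in> low_degree n d" unfolding k_def using g(1) h by (rule low_degree_add_scale)
      moreover have "\<forall>Z'\<in>insert X Y. k Z' = of_bool (Z' = Z)"
        using False hX h0 g(2) by (auto simp: k_def)
      ultimately show ?thesis by blast
    qed
    then have "insert X Y \<in> ?A" using Y X by (auto simp: dual_set_def)
    then show False using max XY by blast
  qed
  then show ?thesis using that Y by blast
qed

subsection \<open>Families with a missing trace in every member\<close>

locale missing_trace =
  fixes n d :: nat and F :: "nat set set" and b :: "nat set \<Rightarrow> nat set"
  assumes F_sub: "F \<subseteq> k_subsets n (d + 1)"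
    and b_psub: "f \<in> F \<Longrightarrow> b f \<subset> f"
    and b_missing: "f \<in> F \<Longrightarrow> g \<in> F \<Longrightarrow> g \<inter> f \<noteq> b f"
    and b_maximal: "f \<in> F \<Longrightarrow> b f \<subset> A \<Longrightarrow> A \<subseteq> f \<Longrightarrow> \<exists>g\<in>F. g \<inter> f = A"
begin

lemma finite_F: "finite F"
  using F_sub finite_subset[OF _ finite_k_subsets] by blast

lemma F_member:
  assumes "f \<in> F"
  shows "f \<subseteq> {1..n}" "card f = d + 1" "finite f"
  using assms F_sub k_subsets_finite[of f n "d + 1"] by (auto simp: k_subsets_def)

lemma F_subset_eq: "f \<in> F \<Longrightarrow> finite X \<Longrightarrow> card X = d + 1 \<Longrightarrow> f \<subseteq> X \<Longrightarrow> f = X"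
  using card_subset_eq[of X f] F_member(2)[of f] by simp

text \<open>\<open>f - R\<close> meets every edge of the link because \<open>R\<close> is not a
  trace on \<open>f\<close>; maximality supplies a member with trace \<open>insert x R\<close>,
  which gives the private edge at \<open>x\<close>.\<close>

lemma card_fibre: "card {f \<in> F. b f = R} \<le> (d + 1) ^ (d + 1)"
proof -
  let ?H = "(\<lambda>g. g - R) ` {g \<in> F. R \<subseteq> g}"
  have H: "finite E \<and> card E \<le> d + 1" if E: "E \<in> ?H" for E
  proof -
    obtain g where g: "g \<in> F" "E = g - R" using E by blast
    then show ?thesis using F_member[OF g(1)] card_mono[of g "g - R"] by auto
  qed
  have "f - R \<in> {C \<in> min_covers ?H. card C \<le> d + 1}" if f: "f \<in> F" "b f = R" for f
  proof -
    have "(f - R) \<inter> (g - R) \<noteq> {}" if g: "g \<in> F" "R \<subseteq> g" for g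
      using b_missing[OF f(1) g(1)] b_psub[OF f(1)] f(2) g(2) by blast
    moreover have "\<exists>E\<in>?H. (f - R) \<inter> E = {x}" if x: "x \<in> f - R" for x
    proof -
      have "R \<subset> insert x R" "insert x R \<subseteq> f" using x f b_psub[OF f(1)] by blast+
      then obtain g where g: "g \<in> F" "g \<inter> f = insert x R" using b_maximal[OF f(1)] f(2) by blast
      then have "(f - R) \<inter> (g - R) = {x}" "R \<subseteq> g" using x by blast+
      then show ?thesis using g(1) by blast
    qed
    ultimately show ?thesis
      using F_member[OF f(1)] card_mono[of f "f - R"] by (auto simp: min_covers_def)
  qed
  then have "(\<lambda>f. f - R) ` {f \<in> F. b f = R} \<subseteq> {C \<in> min_covers ?H. card C \<le> d + 1}"
    by blast
  moreover have "inj_on (\<lambda>f. f - R) {f \<in> F. b f = R}"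
  proof (rule inj_onI)
    fix f g assume *: "f \<in> {f \<in> F. b f = R}" "g \<in> {f \<in> F. b f = R}" "f - R = g - R"
    then have "R \<subseteq> f" "R \<subseteq> g" using b_psub by blast+
    then show "f = g" using *(3) by blast
  qed
  ultimately have "card {f \<in> F. b f = R} \<le> card {C \<in> min_covers ?H. card C \<le> d + 1}"
    using card_min_covers(1)[OF H] by (intro card_inj_on_le) auto
  also have "\<dots> \<le> (d + 1) ^ (d + 1)" using card_min_covers(2)[OF H] by simp
  finally show ?thesis .
qed

lemma card_small_trace: "card {f \<in> F. card (b f) \<le> j} \<le> (n + 1) ^ j * (d + 1) ^ (d + 1)"
proof -
  let ?T = "{R. R \<subseteq> {1..n} \<and> card R \<le> j}"
  have fin: "finite ?T" by (rule finite_subset[of _ "Pow {1..n}"]) auto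
  have "{f \<in> F. card (b f) \<le> j} \<subseteq> (\<Union>R\<in>?T. {f \<in> F. b f = R})"
  proof
    fix f assume f: "f \<in> {f \<in> F. card (b f) \<le> j}"
    then have "b f \<subseteq> {1..n}" using b_psub[of f] F_member(1)[of f] by blast
    then show "f \<in> (\<Union>R\<in>?T. {f \<in> F. b f = R})" using f by blast
  qed
  then have "card {f \<in> F. card (b f) \<le> j} \<le> card (\<Union>R\<in>?T. {f \<in> F. b f = R})"
    by (rule card_mono[rotated]) (use fin finite_F in auto)
  also have "\<dots> \<le> (\<Sum>R\<in>?T. card {f \<in> F. b f = R})"
    by (rule card_UN_le[OF fin])
  also have "\<dots> \<le> (\<Sum>R\<in>?T. (d + 1) ^ (d + 1))"
    by (intro sum_mono card_fibre)
  also have "\<dots> \<le> (n + 1) ^ j * (d + 1) ^ (d + 1)"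
    using mult_le_mono1[OF card_subsets_le[OF finite_atLeastAtMost[of 1 n], of j], of "(d + 1) ^ (d + 1)"] by simp
  finally show ?thesis .
qed

section \<open>Interpolation on the family\<close>

definition P :: "nat set \<Rightarrow> nat set \<Rightarrow> real" where
  "P f X = of_bool (f \<subseteq> X) - (- 1) ^ card (f - b f) * of_bool (X \<inter> f = b f)"

text \<open>\<open>X \<inter> f = b f\<close> asks \<open>X\<close> to contain \<open>b f\<close>
  and avoid \<open>f - b f\<close>. The top term of its indicator is the monomial of
  \<open>f\<close> with sign \<open>(- 1) ^ card (f - b f)\<close>, so the terms of degree
  \<open>d + 1\<close> in \<open>P f\<close> cancel.\<close>

lemma P_low_degree:
  assumes f: "f \<in> F"
  shows "P f \<in> low_degree n d"
proof -
  let ?q = "card (f - b f)"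
  have b: "b f \<subseteq> f" "finite (b f)" using b_psub[OF f] F_member(3)[OF f] finite_subset by blast+
  have "card (b f) + ?q = d + 1"
    using b F_member(2,3)[OF f] card_mono[of f "b f"] by (simp add: card_Diff_subset)
  then have "(\<lambda>X. of_bool (b f \<subseteq> X \<and> (f - b f) \<inter> X = {}) -
      (- 1) ^ ?q * of_bool (b f \<union> (f - b f) \<subseteq> X)) \<in> low_degree n d"
    using b F_member(3)[OF f] by (intro low_degree_avoid_top) auto
  then have "(\<lambda>X. - ((- 1) ^ ?q) * (of_bool (b f \<subseteq> X \<and> (f - b f) \<inter> X = {}) -
      (- 1) ^ ?q * of_bool (b f \<union> (f - b f) \<subseteq> X))) \<in> low_degree n d"
    by (rule low_degree_scale)
  moreover have "- ((- 1) ^ ?q) * (of_bool (b f \<subseteq> X \<and> (f - b f) \<inter> X = {}) -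
      (- 1) ^ ?q * of_bool (b f \<union> (f - b f) \<subseteq> X)) = P f X" for X
  proof -
    have "(b f \<subseteq> X \<and> (f - b f) \<inter> X = {}) = (X \<inter> f = b f)" "b f \<union> (f - b f) = f"
      using b(1) by blast+
    moreover have "(- 1) ^ ?q * (- 1) ^ ?q = (1 :: real)"
      by (simp flip: power_mult_distrib)
    ultimately show ?thesis
      by (simp add: P_def right_diff_distrib flip: mult.assoc)
  qed
  ultimately show ?thesis by simp
qed

lemma P_dual:
  assumes "f \<in> F" "g \<in> F"
  shows "P f g = of_bool (g = f)"
  using b_missing[OF assms] F_subset_eq[OF assms(1), of g] F_member[OF assms(2)]
  by (auto simp: P_def)

lemma dual_set_F: "dual_set n d F"
  unfolding dual_set_def using F_sub P_low_degree P_dual by blast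

text \<open>The sum interpolates the monomial of \<open>A\<close> on \<open>F\<close>;
  \<open>w A\<close> is the interpolation error.\<close>

definition w :: "nat set \<Rightarrow> nat set \<Rightarrow> real" where
  "w A X = of_bool (A \<subseteq> X) - (\<Sum>f\<in>{f \<in> F. A \<subseteq> f}. P f X)"

lemma w_low_degree:
  assumes "card A \<le> d"
  shows "w A \<in> low_degree n d"
proof -
  have "(\<lambda>X. of_bool (A \<subseteq> X) - (\<Sum>f\<in>{f \<in> F. A \<subseteq> f}. P f X)) \<in> low_degree n d"
    by (intro low_degree_diff low_degree_monomial low_degree_sum assms P_low_degree) simp
  then show ?thesis by (simp add: w_def[abs_def])
qed

lemma w_inside:
  assumes "g \<in> F"
  shows "w A g = 0"
proof -
  have "(\<Sum>f\<in>{f \<in> F. A \<subseteq> f}. P f g) = (\<Sum>f\<in>{f \<in> F. A \<subseteq> f}. if f = g then 1 else 0)"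
    by (intro sum.cong) (use assms P_dual in auto)
  then show ?thesis using assms finite_F by (simp add: w_def)
qed

text \<open>Off \<open>F\<close> no member lies inside \<open>X\<close>, so only the second term of
  each \<open>P f X\<close> survives.\<close>

lemma w_outside:
  assumes "X \<in> k_subsets n (d + 1)" "X \<notin> F"
  shows "w A X = of_bool (A \<subseteq> X) + (\<Sum>f\<in>{f \<in> F. A \<subseteq> f \<and> X \<inter> f = b f}. (- 1) ^ card (f - b f))"
proof -
  have "\<not> f \<subseteq> X" if "f \<in> F" for f
    using F_subset_eq[OF that, of X] assms that k_subsets_finite[OF assms(1)]
    by (auto simp: k_subsets_def)
  then have "(\<Sum>f\<in>{f \<in> F. A \<subseteq> f}. P f X)
      = (\<Sum>f\<in>{f \<in> F. A \<subseteq> f}. if X \<inter> f = b f then - ((- 1) ^ card (f - b f)) else 0)"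
    by (intro sum.cong) (auto simp: P_def)
  also have "\<dots> = (\<Sum>f\<in>{f \<in> F. A \<subseteq> f \<and> X \<inter> f = b f}. - ((- 1) ^ card (f - b f)))"
    using finite_F by (subst sum.inter_filter[symmetric]) (auto intro!: sum.cong)
  finally show ?thesis by (simp add: w_def sum_negf)
qed

text \<open>A member \<open>f\<close> contributes only if \<open>X \<inter> f = b f\<close>, but
  then \<open>card (b f)\<close> is at most \<open>card (X \<inter> A) + (d + 1 - card A)\<close>,
  which is below \<open>d - 1\<close>.\<close>

lemma w_far:
  assumes A: "card A \<le> d" "finite A"
    and b: "\<And>f. f \<in> F \<Longrightarrow> A \<subseteq> f \<Longrightarrow> d - 1 \<le> card (b f)"
    and X: "X \<in> k_subsets n (d + 1)" "X \<notin> F" "card (X \<inter> A) + 2 < card A"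
  shows "w A X = 0"
proof -
  have "\<not> A \<subseteq> X" using X(3) by (auto simp: Int_absorb1)
  moreover have "X \<inter> f \<noteq> b f" if f: "f \<in> F" "A \<subseteq> f" for f
  proof
    assume eq: "X \<inter> f = b f"
    have "card (X \<inter> f) \<le> card ((X \<inter> A) \<union> (f - A))"
      using F_member(3)[OF f(1)] A(2) by (intro card_mono) auto
    also have "\<dots> \<le> card (X \<inter> A) + card (f - A)" by (rule card_Un_le)
    also have "card (f - A) = d + 1 - card A"
      using f A F_member[OF f(1)] by (simp add: card_Diff_subset)
    finally show False using b[OF f] X(3) A(1) unfolding eq by arith
  qed
  ultimately show ?thesis
    using w_outside[OF X(1,2), of A] by (simp cong: conj_cong add: sum.neutral)
qed

section \<open>Complete links\<close>

lemma trace_unique: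
  assumes f: "f \<in> F" "card (b f) = d" and g: "g \<in> F" "b f \<subseteq> g"
  shows "g = f"
proof -
  \<comment> \<open>\<open>g \<inter> f\<close> contains \<open>b f\<close> and differs from it; as
    \<open>card (b f) = d\<close>, only \<open>f\<close> itself is left.\<close>
  have "b f \<subset> g \<inter> f" using b_missing[OF f(1) g(1)] b_psub[OF f(1)] g(2) by blast
  then have "card (b f) < card (g \<inter> f)" using F_member(3)[OF f(1)] by (intro psubset_card_mono) auto
  then have "card f \<le> card (g \<inter> f)" using f F_member(2)[OF f(1)] by simp
  then have "g \<inter> f = f" using F_member(3)[OF f(1)] by (intro card_seteq) auto
  then show ?thesis using F_subset_eq[OF f(1)] F_member[OF g(1)] by blast
qed

text \<open>The monomial contributes 1 to \<open>w D X = 0\<close>, so some member must cancel it;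
  its \<open>b f\<close> contains \<open>D\<close> and has at most \<open>d\<close> points.\<close>

lemma trace_of_not_full:
  assumes D: "card D = d" and w: "w D X = 0"
    and X: "X \<in> k_subsets n (d + 1)" "X \<notin> F" "D \<subseteq> X"
  shows "\<exists>f\<in>F. b f = D"
proof -
  have "{f \<in> F. D \<subseteq> f \<and> X \<inter> f = b f} \<noteq> {}"
  proof
    assume "{f \<in> F. D \<subseteq> f \<and> X \<inter> f = b f} = {}"
    then show False using w_outside[OF X(1,2), of D] w X(3) by (simp only:) simp
  qed
  then obtain f where f: "f \<in> F" "D \<subseteq> f" "X \<inter> f = b f" by blast
  have "card (b f) < card f" using b_psub[OF f(1)] F_member(3)[OF f(1)] by (rule psubset_card_mono[rotated])
  moreover have "D \<subseteq> b f" using f X(3) by blast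
  moreover have "finite (b f)" using F_member(3)[OF f(1)] b_psub[OF f(1)] finite_subset by blast
  ultimately have "D = b f" using card_seteq[of "b f" D] D F_member(2)[OF f(1)] by simp
  then show ?thesis using f(1) by blast
qed

text \<open>If the set were not in \<open>F\<close>, then \<open>insert x S\<close> and
  \<open>insert y S\<close> would be the values of \<open>b\<close> at members \<open>fx\<close> and
  \<open>fy\<close>. Evaluating \<open>w S\<close> then requires a member \<open>f\<close> with
  \<open>b f = S\<close>, whose two points outside \<open>S\<close> lead to two different members
  containing \<open>b fx\<close>, against \<open>trace_unique\<close>.\<close>

lemma complete_link:
  assumes S: "S \<in> k_subsets n (d - 1)" and "d \<ge> 1"
    and wS: "\<And>X. X \<in> k_subsets n (d + 1) \<Longrightarrow> w S X = 0"
    and wD: "\<And>a X. a \<in> {1..n} - S \<Longrightarrow> X \<in> k_subsets n (d + 1) \<Longrightarrow> w (insert a S) X = 0"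
    and xy: "x \<in> {1..n} - S" "y \<in> {1..n} - S" "x \<noteq> y"
  shows "insert x (insert y S) \<in> F"
proof (rule ccontr)
  let ?X = "insert x (insert y S)"
  assume XF: "?X \<notin> F"
  have finS: "finite S" and cardS: "card S = d - 1" and Sn: "S \<subseteq> {1..n}"
    using S k_subsets_finite[OF S] by (auto simp: k_subsets_def)
  have pair: "insert u (insert v S) \<in> k_subsets n (d + 1)"
    if "u \<in> {1..n} - S" "v \<in> {1..n} - S" "u \<noteq> v" for u v
    using that finS cardS Sn \<open>d \<ge> 1\<close> by (auto simp: k_subsets_def)
  have cardD: "card (insert u S) = d" if "u \<notin> S" for u
    using that finS cardS \<open>d \<ge> 1\<close> by simp
  have own: "\<exists>f\<in>F. b f = insert u S"
    if u: "u \<in> {1..n} - S" "v \<in> {1..n} - S" "u \<noteq> v" "insert u (insert v S) \<notin> F" for u v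
    using trace_of_not_full[OF cardD wD[OF u(1) pair[OF u(1-3)]] pair[OF u(1-3)] u(4)] u(1) by auto
  obtain fx where fx: "fx \<in> F" "b fx = insert x S" using own[OF xy XF] by blast
  have "insert y (insert x S) \<notin> F" using XF by (simp add: insert_commute)
  then obtain fy where fy: "fy \<in> F" "b fy = insert y S" using own[OF xy(2,1)] xy(3) by blast
  have neq: "fx \<noteq> fy" using fx(2) fy(2) xy by auto
  have Xin: "?X \<in> k_subsets n (d + 1)" using pair[OF xy] .
  have cardX: "card ?X = d + 1" and finX: "finite ?X"
    using Xin k_subsets_finite[OF Xin] by (auto simp: k_subsets_def)
  have not_top: "?X \<inter> f \<noteq> ?X" if "f \<in> F" for f
    using F_member[OF that] XF finX cardX that by (metis card_subset_eq inf.absorb_iff1)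
  have trace_X: "?X \<inter> f = insert u S"
    if f: "f \<in> F" "b f = insert u S" and u: "u \<in> {x, y}" for f u
  proof -
    have "insert u S \<subseteq> ?X \<inter> f" using b_psub[OF f(1)] f(2) u by blast
    moreover have "card (?X \<inter> f) < card ?X" using finX not_top[OF f(1)] by (intro psubset_card_mono) auto
    then have "card (?X \<inter> f) \<le> card (insert u S)" using cardX cardD u xy by auto
    ultimately show ?thesis using card_seteq[of "?X \<inter> f" "insert u S"] finX by blast
  qed
  have "\<exists>f\<in>F. b f = S"
  proof (rule ccontr)
    assume no: "\<not> (\<exists>f\<in>F. b f = S)"
    \<comment> \<open>Without a member having \<open>b f = S\<close>, exactly \<open>fx\<close> and
      \<open>fy\<close> contribute, each with -1, and \<open>w S ?X\<close> would be 1 - 2 rather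
      than 0.\<close>
    have "{f \<in> F. S \<subseteq> f \<and> ?X \<inter> f = b f} = {fx, fy}"
    proof (intro equalityI subsetI)
      fix f assume f: "f \<in> {f \<in> F. S \<subseteq> f \<and> ?X \<inter> f = b f}"
      then have f': "f \<in> F" "S \<subseteq> f" "?X \<inter> f = b f" by auto
      have "b f \<noteq> S" using f'(1) no by blast
      moreover have "?X \<inter> f = S" if "x \<notin> f" "y \<notin> f" using that f'(2) by auto
      moreover have "?X \<inter> f = ?X" if "x \<in> f" "y \<in> f" using that f'(2) by auto
      ultimately consider "x \<in> f" "y \<notin> f" | "x \<notin> f" "y \<in> f"
        using not_top[OF f'(1)] f'(3) by metis
      then have "b f = insert x S \<or> b f = insert y S"
      proof cases
        case 1
        then have "?X \<inter> f = insert x S" using f'(2) by auto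
        then show ?thesis using f'(3) by simp
      next
        case 2
        then have "?X \<inter> f = insert y S" using f'(2) by auto
        then show ?thesis using f'(3) by simp
      qed
      moreover have "b f \<subseteq> f" using f b_psub by blast
      ultimately have "f = fx \<or> f = fy"
        using trace_unique[of fx f] trace_unique[of fy f] fx fy cardD xy f by auto
      then show "f \<in> {fx, fy}" by blast
    next
      fix f assume "f \<in> {fx, fy}"
      then show "f \<in> {f \<in> F. S \<subseteq> f \<and> ?X \<inter> f = b f}"
        using trace_X[OF fx] trace_X[OF fy] fx fy b_psub[OF fx(1)] b_psub[OF fy(1)] by auto
    qed
    moreover have "card (f - b f) = 1" if "f \<in> {fx, fy}" for f
    proof -
      have "f \<in> F" "card (b f) = d" using that fx fy cardD xy by auto
      then show ?thesis
        using F_member[of f] b_psub[of f] card_Diff_subset[of "b f" f] finite_subset[of "b f" f] by auto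
    qed
    ultimately have "w S ?X = 1 + (\<Sum>f\<in>{fx, fy}. - 1)"
      using w_outside[OF Xin XF, of S] by (simp add: subset_insertI2)
    then show False using wS[OF Xin] neq by simp
  qed
  then obtain f where f: "f \<in> F" "b f = S" by blast
  have Sf: "S \<subset> f" using b_psub[OF f(1)] f(2) by simp
  have "card (f - S) = 2"
    using F_member[OF f(1)] Sf finS cardS \<open>d \<ge> 1\<close> by (simp add: card_Diff_subset psubset_imp_subset)
  then obtain p q where pq: "f - S = {p, q}" "p \<noteq> q" by (meson card_2_iff)
  \<comment> \<open>Maximality of \<open>b f = S\<close> makes \<open>insert u S\<close> part of a
    second member. A value of \<open>b\<close> of size \<open>d\<close> lies in only one member, so
    \<open>insert u S\<close> is no such value, and by \<open>own\<close> the
    \<open>(d + 1)\<close>-sets containing it are in \<open>F\<close>.\<close>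
  have shared: "\<exists>g\<in>F. g \<noteq> f \<and> insert u S \<subseteq> g" if u: "u \<in> f - S" for u
  proof -
    have "S \<subset> insert u S" "insert u S \<subseteq> f" using u Sf by blast+
    then obtain g where g: "g \<in> F" "g \<inter> f = insert u S" using b_maximal[OF f(1)] f(2) by blast
    then have "g \<noteq> f" using pq u by auto
    then show ?thesis using g by blast
  qed
  have not_own: "b g \<noteq> insert u S" if u: "u \<in> f - S" and g: "g \<in> F" for u g
  proof
    assume eq: "b g = insert u S"
    have "card (b g) = d" using cardD u eq by simp
    moreover obtain h where "h \<in> F" "h \<noteq> f" "insert u S \<subseteq> h" using shared[OF u] by blast
    moreover have "insert u S \<subseteq> f" using u Sf by blast
    ultimately show False using trace_unique[OF g] eq f(1) by metis
  qed
  have full: "insert u (insert x S) \<in> F" if u: "u \<in> f - S" for u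
  proof (rule ccontr)
    assume "insert u (insert x S) \<notin> F"
    moreover have "u \<in> {1..n} - S" using u F_member[OF f(1)] by blast
    moreover have "u \<noteq> x" using not_own[OF u fx(1)] fx(2) by blast
    ultimately show False using own[OF _ xy(1)] not_own[OF u] by blast
  qed
  \<comment> \<open>Both members contain \<open>b fx\<close>, so both are \<open>fx\<close>,
    although \<open>p \<noteq> q\<close>.\<close>
  have "insert p (insert x S) = fx" "insert q (insert x S) = fx"
    using trace_unique[OF fx(1)] fx(2) cardD xy(1) full pq by auto
  moreover have "p \<noteq> x" "q \<noteq> x" "p \<notin> S" using not_own[OF _ fx(1)] fx(2) pq by blast+
  ultimately show False using pq(2) by blast
qed

text \<open>Double counting of the pairs \<open>S \<subseteq> f\<close>; \<open>n + 1 - d\<close> is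
  the size of the complement of \<open>S\<close>, and a member has \<open>2 ^ (d + 1)\<close>
  subsets.\<close>

lemma card_complete_links:
  assumes T: "T \<subseteq> k_subsets n (d - 1)" and "d \<ge> 1"
    and complete: "\<And>S x y. S \<in> T \<Longrightarrow> x \<in> {1..n} - S \<Longrightarrow> y \<in> {1..n} - S \<Longrightarrow> x \<noteq> y \<Longrightarrow>
      insert x (insert y S) \<in> F"
  shows "card T * ((n + 1 - d) choose 2) \<le> card F * 2 ^ (d + 1)"
proof -
  have finT: "finite T" using T finite_subset[OF _ finite_k_subsets] by blast
  have "(n + 1 - d) choose 2 \<le> card {f \<in> F. S \<subseteq> f}" if S: "S \<in> T" for S
  proof -
    let ?E = "{E. E \<subseteq> {1..n} - S \<and> card E = 2}"
    have S': "S \<subseteq> {1..n}" "card S = d - 1" using S T by (auto simp: k_subsets_def)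
    have "S \<union> E \<in> {f \<in> F. S \<subseteq> f}" if E: "E \<in> ?E" for E
    proof -
      obtain x y where "E = {x, y}" "x \<noteq> y" using E by (auto simp: card_2_iff)
      then show ?thesis using complete[OF S, of x y] E by auto
    qed
    moreover have "inj_on (\<lambda>E. S \<union> E) ?E"
      by (rule inj_onI) blast
    ultimately have "card ?E \<le> card {f \<in> F. S \<subseteq> f}"
      using finite_F by (intro card_inj_on_le[of "\<lambda>E. S \<union> E"]) auto
    moreover have "card ?E = (n + 1 - d) choose 2"
      using S' \<open>d \<ge> 1\<close> finite_subset[OF S'(1)] by (simp add: n_subsets card_Diff_subset)
    ultimately show ?thesis by simp
  qed
  then have "card T * ((n + 1 - d) choose 2) \<le> (\<Sum>S\<in>T. card {f \<in> F. S \<subseteq> f})"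
    using sum_mono[of T "\<lambda>_. (n + 1 - d) choose 2" "\<lambda>S. card {f \<in> F. S \<subseteq> f}"] by simp
  also have "\<dots> = (\<Sum>S\<in>T. \<Sum>f\<in>F. of_bool (S \<subseteq> f))"
    using finite_F by (simp add: Int_def)
  also have "\<dots> = (\<Sum>f\<in>F. \<Sum>S\<in>T. of_bool (S \<subseteq> f))" by (rule sum.swap)
  also have "\<dots> = (\<Sum>f\<in>F. card {S \<in> T. S \<subseteq> f})"
    using finT by (simp add: Int_def)
  also have "\<dots> \<le> (\<Sum>f\<in>F. 2 ^ (d + 1))"
  proof (rule sum_mono)
    fix f assume f: "f \<in> F"
    have "card {S \<in> T. S \<subseteq> f} \<le> card (Pow f)"
      using F_member(3)[OF f] by (intro card_mono) auto
    also have "\<dots> = 2 ^ (d + 1)" using F_member[OF f] card_Pow[of f] by simp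
    finally show "card {S \<in> T. S \<subseteq> f} \<le> 2 ^ (d + 1)" .
  qed
  finally show ?thesis by simp
qed

end

subsection \<open>The bound\<close>

text \<open>Each member with small \<open>b f\<close> spoils only its own subsets, and
  \<open>card_small_trace\<close> bounds the number of such members.\<close>

lemma (in missing_trace) card_bad_trace:
  "card {S \<in> k_subsets n (d - 1). \<exists>f\<in>F. S \<subseteq> f \<and> card (b f) \<le> d - 2}
    \<le> (n + 1) ^ (d - 2) * (d + 1) ^ (d + 1) * 2 ^ (d + 1)"
proof -
  let ?G = "{f \<in> F. card (b f) \<le> d - 2}"
  have fin: "finite ?G" using finite_F by simp
  have "card {S \<in> k_subsets n (d - 1). \<exists>f\<in>F. S \<subseteq> f \<and> card (b f) \<le> d - 2} \<le> card (\<Union>f\<in>?G. Pow f)"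
    using fin F_member(3) by (intro card_mono) auto
  also have "\<dots> \<le> (\<Sum>f\<in>?G. card (Pow f))" by (rule card_UN_le[OF fin])
  also have "\<dots> = (\<Sum>f\<in>?G. 2 ^ (d + 1))"
    using F_member by (intro sum.cong) (auto simp: card_Pow)
  also have "\<dots> \<le> (n + 1) ^ (d - 2) * (d + 1) ^ (d + 1) * 2 ^ (d + 1)"
    using mult_le_mono1[OF card_small_trace[of "d - 2"], of "2 ^ (d + 1)"] by simp
  finally show ?thesis .
qed

text \<open>\<open>S\<close> is determined by \<open>X \<inter> S\<close> together with the at most
  \<open>j\<close> points of \<open>S - X\<close>.\<close>

lemma card_k_subsets_near:
  assumes X: "finite X" "card X = d + 1"
  shows "card {S \<in> k_subsets n k. card S \<le> card (X \<inter> S) + j} \<le> 2 ^ (d + 1) * (n + 1) ^ j"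
proof -
  let ?N = "{S \<in> k_subsets n k. card S \<le> card (X \<inter> S) + j}"
  let ?T = "{R. R \<subseteq> {1..n} \<and> card R \<le> j}"
  have finT: "finite ?T" by (rule finite_subset[of _ "Pow {1..n}"]) auto
  have "(X \<inter> S, S - X) \<in> Pow X \<times> ?T" if S: "S \<in> ?N" for S
  proof -
    have "finite S" using S k_subsets_finite by blast
    then have "card (S - X) = card S - card (X \<inter> S)"
      by (metis Int_commute card_Diff_subset_Int finite_Int)
    then show ?thesis using S by (auto simp: k_subsets_def)
  qed
  moreover have "inj_on (\<lambda>S. (X \<inter> S, S - X)) ?N"
    by (rule inj_onI) blast
  ultimately have "card ?N \<le> card (Pow X \<times> ?T)"
    using finT X by (intro card_inj_on_le[of "\<lambda>S. (X \<inter> S, S - X)"]) auto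
  also have "\<dots> = 2 ^ (d + 1) * card ?T"
    using X by (simp add: card_cartesian_product card_Pow)
  also have "\<dots> \<le> 2 ^ (d + 1) * (n + 1) ^ j"
    using card_subsets_le[OF finite_atLeastAtMost[of 1 n], of j] by (intro mult_le_mono2) simp
  finally show ?thesis .
qed

text \<open>\<open>n1\<close> ensures that at least half of the \<open>(d - 1)\<close>-sets are
  good; \<open>n2\<close> makes the members forced by them too many.\<close>

lemma (in missing_trace) card_le_choose_minus:
  assumes d: "d \<ge> 4"
    and n1: "2 * ((n + 1) ^ (d - 2) * (((d + 1) ^ (d + 1) + 1) * 2 ^ (d + 1))) \<le> n choose (d - 1)"
    and n2: "2 ^ (d + 3) + d + 1 \<le> n"
  shows "card F + n ^ (d - 4) \<le> n choose d"
proof (rule ccontr)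
  assume "\<not> ?thesis"
  then have big: "n choose d < card F + n ^ (d - 4)" by simp
  obtain Y where Y: "F \<subseteq> Y" "dual_set n d Y" and
    zero: "\<And>h X. h \<in> low_degree n d \<Longrightarrow> (\<And>Z. Z \<in> Y \<Longrightarrow> h Z = 0) \<Longrightarrow> X \<in> k_subsets n (d + 1) \<Longrightarrow> h X = 0"
    using dual_set_extend[OF dual_set_F] by metis
  have Ysub: "Y \<subseteq> k_subsets n (d + 1)" using Y(2) by (simp add: dual_set_def)
  have finY: "finite Y" using finite_subset[OF Ysub finite_k_subsets] .
  define Z where "Z = Y - F"
  have cardZ: "card Z \<le> n ^ (d - 4)"
    using card_dual_set_le[OF Y(2)] big card_Diff_subset[OF finite_F Y(1)]
    unfolding Z_def by linarith
  have cardF: "card F \<le> n choose d" using card_dual_set_le[OF dual_set_F] .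
  let ?K = "k_subsets n (d - 1)"
  \<comment> \<open>\<open>?B1\<close> collects the sets inside a member with small
    \<open>b f\<close>, \<open>?B2\<close> those too close to a further point for
    \<open>w_far\<close>.\<close>
  let ?B1 = "{S \<in> ?K. \<exists>f\<in>F. S \<subseteq> f \<and> card (b f) \<le> d - 2}"
  let ?B2 = "\<Union>X\<in>Z. {S \<in> ?K. card S \<le> card (X \<inter> S) + 2}"
  define T where "T = ?K - (?B1 \<union> ?B2)"
  have finZ: "finite Z" using finY Z_def by simp
  have "card ?B2 \<le> (\<Sum>X\<in>Z. card {S \<in> ?K. card S \<le> card (X \<inter> S) + 2})"
    by (rule card_UN_le[OF finZ])
  also have "\<dots> \<le> (\<Sum>X\<in>Z. 2 ^ (d + 1) * (n + 1) ^ 2)"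
  proof (rule sum_mono)
    fix X assume "X \<in> Z"
    then have X: "X \<in> k_subsets n (d + 1)" using Ysub Z_def by blast
    then have "card X = d + 1" by (simp add: k_subsets_def)
    then show "card {S \<in> ?K. card S \<le> card (X \<inter> S) + 2} \<le> 2 ^ (d + 1) * (n + 1) ^ 2"
      by (rule card_k_subsets_near[OF k_subsets_finite[OF X]])
  qed
  also have "\<dots> \<le> (n + 1) ^ (d - 4) * (2 ^ (d + 1) * (n + 1) ^ 2)"
    using order_trans[OF cardZ power_mono[of n "n + 1" "d - 4"]] by simp
  also have "\<dots> = (n + 1) ^ (d - 2) * 2 ^ (d + 1)"
  proof -
    \<comment> \<open>The exponent \<open>d - 4\<close> enters here: each further point spoils order
      \<open>n ^ 2\<close> sets, so the total stays one order below
      \<open>n choose (d - 1)\<close>.\<close>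
    have "d - 2 = (d - 4) + 2" using d by simp
    then have "(n + 1) ^ (d - 2) = (n + 1) ^ (d - 4) * (n + 1) ^ 2" by (simp only: power_add)
    then show ?thesis by (simp only: mult_ac)
  qed
  finally have B2: "card ?B2 \<le> (n + 1) ^ (d - 2) * 2 ^ (d + 1)" .
  have B: "card (?B1 \<union> ?B2) \<le> (n + 1) ^ (d - 2) * (((d + 1) ^ (d + 1) + 1) * 2 ^ (d + 1))"
    unfolding distrib_right distrib_left mult_1 mult.assoc[symmetric]
    by (rule order_trans[OF card_Un_le add_mono[OF card_bad_trace B2]])
  have "?B1 \<union> ?B2 \<subseteq> ?K" by blast
  then have "card T = (n choose (d - 1)) - card (?B1 \<union> ?B2)"
    unfolding T_def using finite_subset[OF _ finite_k_subsets] by (simp only: card_Diff_subset card_k_subsets)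
  then have T_large: "n choose (d - 1) \<le> 2 * card T" using B n1 by linarith
  \<comment> \<open>This treats \<open>S\<close> and \<open>insert a S\<close> together: an added
    point raises \<open>card (V \<inter> A)\<close> by at most as much as \<open>card A\<close>, so
    the distance to \<open>V\<close> persists.\<close>
  have wzero: "w A X = 0"
    if A: "S \<subseteq> A" "card A \<le> Suc (card S)" "finite A" and S: "S \<in> T" and X: "X \<in> k_subsets n (d + 1)" for S A X
  proof (rule zero[OF w_low_degree _ X])
    have S': "S \<in> ?K" using S T_def by blast
    then have finS: "finite S" "card S = d - 1" using k_subsets_finite[OF S'] by (auto simp: k_subsets_def)
    then show cardA: "card A \<le> d" using A(2) d by linarith
    fix V assume V: "V \<in> Y"
    show "w A V = 0"
    proof (cases "V \<in> F")
      case True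
      then show ?thesis by (rule w_inside)
    next
      case False
      then have VZ: "V \<in> Z" using V Z_def by blast
      show ?thesis
      proof (rule w_far[OF cardA A(3)])
        show "V \<in> k_subsets n (d + 1)" using V Ysub by blast
        show "V \<notin> F" by (rule False)
        fix f assume f: "f \<in> F" "A \<subseteq> f"
        have "\<not> card (b f) \<le> d - 2" using S f A(1) unfolding T_def by blast
        then show "d - 1 \<le> card (b f)" by linarith
      next
        have "S \<notin> ?B2" using S T_def by blast
        then have "\<not> card S \<le> card (V \<inter> S) + 2" using VZ S' by blast
        moreover have "card (V \<inter> A) \<le> card ((V \<inter> S) \<union> (A - S))"
          using A(3) finS(1) by (intro card_mono) auto
        moreover have "card ((V \<inter> S) \<union> (A - S)) \<le> card (V \<inter> S) + card (A - S)" by (rule card_Un_le)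
        moreover have "card (A - S) = card A - card S" "card S \<le> card A"
          using A(1) finS(1) card_mono[OF A(3,1)] by (simp_all add: card_Diff_subset)
        ultimately show "card (V \<inter> A) + 2 < card A" by linarith
      qed
    qed
  qed
  have complete: "insert x (insert y S) \<in> F"
    if S: "S \<in> T" and xy: "x \<in> {1..n} - S" "y \<in> {1..n} - S" "x \<noteq> y" for S x y
  proof (rule complete_link[OF _ _ _ _ xy])
    show S': "S \<in> ?K" using S T_def by blast
    show "1 \<le> d" using d by simp
    have finS: "finite S" using k_subsets_finite[OF S'] .
    show "w S X = 0" if "X \<in> k_subsets n (d + 1)" for X
      by (rule wzero[OF _ _ _ S that]) (use finS in auto)
    show "w (insert a S) X = 0" if "X \<in> k_subsets n (d + 1)" for a X
      by (rule wzero[OF _ _ _ S that]) (use finS card_insert_le_m1 in \<open>auto simp: card_insert_if\<close>)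
  qed
  let ?C = "n choose (d - 1)" and ?m = "n + 1 - d"
  have "card T * (?m choose 2) \<le> card F * 2 ^ (d + 1)"
    using d complete by (intro card_complete_links) (auto simp: T_def)
  also have "\<dots> \<le> (n choose d) * 2 ^ (d + 1)" using cardF by simp
  also have "\<dots> \<le> ?m * ?C * 2 ^ (d + 1)"
  proof -
    \<comment> \<open>Absorption trades \<open>n choose d\<close> for
      \<open>n choose (d - 1)\<close>, so that \<open>?C\<close> cancels at the end.\<close>
    have "(n choose d) \<le> d * (n choose d)" using d by simp
    also have "\<dots> = ?m * ?C"
      using d binomial_absorb_comp[of n "d - 1"] times_binomial_minus1_eq[of d n] by simp
    finally show ?thesis by simp
  qed
  finally have 1: "card T * (?m choose 2) \<le> ?m * ?C * 2 ^ (d + 1)" .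
  \<comment> \<open>One factor 2 from this binomial and one from \<open>T_large\<close> turn
    \<open>2 ^ (d + 1)\<close> into \<open>2 ^ (d + 3)\<close>.\<close>
  have "2 * (?m choose 2) = ?m * ((?m - 1) choose 1)"
    using times_binomial_minus1_eq[of 2 ?m] by (simp only: one_add_one[symmetric] add_diff_cancel_right')
  then have "?C * (?m * (?m - 1)) = ?C * (2 * (?m choose 2))"
    by (simp only: choose_one)
  also have "\<dots> \<le> (2 * card T) * (2 * (?m choose 2))" using T_large by (rule mult_le_mono1)
  also have "\<dots> = 4 * (card T * (?m choose 2))" by simp
  also have "\<dots> \<le> 4 * (?m * ?C * 2 ^ (d + 1))" using 1 by linarith
  also have "\<dots> = ?C * (?m * 2 ^ (d + 3))" by (simp add: power_add)
  finally have "?C * (?m * (?m - 1)) \<le> ?C * (?m * 2 ^ (d + 3))" .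
  moreover have "?C > 0" "?m > 0" using n2 by auto
  ultimately have "?m - 1 \<le> 2 ^ (d + 3)" by simp
  then show False using n2 by simp
qed

section \<open>From VC-dimension to missing traces\<close>

lemma vc_dim_ge_card:
  assumes fin: "finite F" "\<And>X. X \<in> F \<Longrightarrow> finite X" and S: "finite S" "shatters F S"
  shows "card S \<le> vc_dim F"
proof -
  \<comment> \<open>A shattered set is a trace of itself, so it lies inside a member; this
    boundedness makes the \<open>Sup\<close> an upper bound.\<close>
  have "card S' \<le> Max (card ` F)" if S': "shatters F S'" for S'
  proof -
    obtain X where X: "X \<in> F" "X \<inter> S' = S'" using S' unfolding shatters_def by blast
    then have "card S' \<le> card X" using fin(2) by (intro card_mono) auto
    also have "\<dots> \<le> Max (card ` F)" using X fin(1) by simp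
    finally show ?thesis .
  qed
  then have "bdd_above {card S | S. finite S \<and> shatters F S}"
    by (intro bdd_aboveI[of _ "Max (card ` F)"]) auto
  then show ?thesis unfolding vc_dim_def using S by (intro cSup_upper) auto
qed

text \<open>A member has \<open>d + 1\<close> points and so is not shattered; take a maximal subset
  that is not a trace. It is proper because \<open>f\<close> is its own trace.\<close>

lemma missing_trace_exists:
  assumes F: "F \<subseteq> k_subsets n (d + 1)" and vc: "vc_dim F \<le> d"
  obtains b where "missing_trace n d F b"
proof -
  have finF: "finite F" using finite_subset[OF F finite_k_subsets] .
  have mem: "finite f" "card f = d + 1" if "f \<in> F" for f
    using that F k_subsets_finite[of f] by (auto simp: k_subsets_def)
  have "\<exists>B. B \<subset> f \<and> (\<forall>g\<in>F. g \<inter> f \<noteq> B) \<and> (\<forall>A. B \<subset> A \<longrightarrow> A \<subseteq> f \<longrightarrow> (\<exists>g\<in>F. g \<inter> f = A))"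
    if f: "f \<in> F" for f
  proof -
    let ?M = "{B. B \<subseteq> f \<and> (\<forall>g\<in>F. g \<inter> f \<noteq> B)}"
    have "\<not> shatters F f" using vc_dim_ge_card[OF finF mem(1) mem(1)[OF f]] mem(2)[OF f] vc by auto
    then have "?M \<noteq> {}" unfolding shatters_def by blast
    moreover have "finite ?M" using mem(1)[OF f] by simp
    ultimately have "\<exists>B\<in>?M. \<forall>A\<in>?M. B \<subseteq> A \<longrightarrow> B = A" by (intro finite_has_maximal)
    then obtain B where B: "B \<in> ?M" and max: "\<forall>A\<in>?M. B \<subseteq> A \<longrightarrow> B = A" ..
    have "B \<noteq> f" using B f by blast
    moreover have "\<exists>g\<in>F. g \<inter> f = A" if "B \<subset> A" "A \<subseteq> f" for A
    proof (rule ccontr)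
      assume "\<not> ?thesis"
      then have "A \<in> ?M" using that by blast
      then show False using max that(1) by blast
    qed
    ultimately show ?thesis using B by blast
  qed
  then obtain b where "\<forall>f\<in>F. b f \<subset> f \<and> (\<forall>g\<in>F. g \<inter> f \<noteq> b f) \<and>
      (\<forall>A. b f \<subset> A \<longrightarrow> A \<subseteq> f \<longrightarrow> (\<exists>g\<in>F. g \<inter> f = A))" by metis
  then have "missing_trace n d F b" using F by unfold_locales auto
  then show ?thesis by (rule that)
qed

text \<open>From \<open>n choose k\<close> being at least \<open>(n / k) ^ k\<close> and
  \<open>n + 1 \<le> 2 * n\<close>: the one spare factor \<open>n\<close> pays for all the
  constants.\<close>

lemma power_le_choose:
  assumes "k \<ge> 1" and n: "L * 2 ^ (k - 1) * k ^ k \<le> n" "k \<le> n"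
  shows "(n + 1) ^ (k - 1) * L \<le> n choose k"
proof -
  have "(real n / real k) ^ k \<le> real (n choose k)"
    using binomial_ge_n_over_k_pow_k[OF n(2)] by simp
  then have "real (n ^ k) \<le> real ((n choose k) * k ^ k)"
    using \<open>k \<ge> 1\<close> by (simp add: power_divide divide_le_eq)
  then have *: "n ^ k \<le> (n choose k) * k ^ k" by (simp only: of_nat_le_iff)
  have "(n + 1) ^ (k - 1) \<le> (2 * n) ^ (k - 1)" using assms by (intro power_mono) auto
  then have "((n + 1) ^ (k - 1) * L) * k ^ k \<le> (2 ^ (k - 1) * n ^ (k - 1) * L) * k ^ k"
    by (simp add: power_mult_distrib)
  also have "\<dots> = (L * 2 ^ (k - 1) * k ^ k) * n ^ (k - 1)" by simp
  also have "\<dots> \<le> n * n ^ (k - 1)" using n(1) by (rule mult_le_mono1)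
  also have "\<dots> = n ^ k" using \<open>k \<ge> 1\<close> by (cases k) auto
  also note *
  finally show ?thesis using \<open>k \<ge> 1\<close> by simp
qed

theorem theorem4p1:
  fixes d :: nat
  assumes "d \<ge> 4"
  shows "\<exists>c::real. c > 0 \<and> (\<exists>n0::nat. \<forall>n\<ge>n0. \<forall>F.
           F \<subseteq> k_subsets n (d + 1) \<and> vc_dim F \<le> d \<longrightarrow>
           real (card F) \<le> real (n choose d) - c * real n ^ (d - 4))"
proof -
  define L where "L = 2 * (((d + 1) ^ (d + 1) + 1) * 2 ^ (d + 1))"
  \<comment> \<open>The first summand is what \<open>power_le_choose\<close> asks for
    \<open>k = d - 1\<close>; the others give the second size condition on \<open>n\<close>. With
    this \<open>n0\<close>, the constant \<open>c = 1\<close> works.\<close>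
  define n0 where "n0 = L * 2 ^ (d - 2) * (d - 1) ^ (d - 1) + 2 ^ (d + 3) + d + 1"
  have "real (card F) \<le> real (n choose d) - 1 * real n ^ (d - 4)"
    if n: "n \<ge> n0" and F: "F \<subseteq> k_subsets n (d + 1)" "vc_dim F \<le> d" for n F
  proof -
    obtain b where "missing_trace n d F b" using missing_trace_exists[OF F] .
    moreover have "(n + 1) ^ (d - 2) * L \<le> n choose (d - 1)"
      using power_le_choose[of "d - 1" L n] n assms by (simp add: n0_def numeral_eq_Suc)
    then have "2 * ((n + 1) ^ (d - 2) * (((d + 1) ^ (d + 1) + 1) * 2 ^ (d + 1))) \<le> n choose (d - 1)"
      unfolding L_def by (simp only: mult.left_commute[of 2])
    ultimately have "card F + n ^ (d - 4) \<le> n choose d"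
      using missing_trace.card_le_choose_minus[of n d F b] assms n by (simp add: n0_def)
    then have "real (card F + n ^ (d - 4)) \<le> real (n choose d)" by (simp only: of_nat_le_iff)
    then show ?thesis by simp
  qed
  then show ?thesis by (intro exI[of _ 1] conjI exI[of _ n0]) auto
qed

end
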